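(* Let $f$ be a cubic polynomial having a $2$-cycle of Siegel disks with rotation number $\theta$, and let $\lambda=e^{2\pi i\theta}$. Then $f$ is conformally conjugate to $$f_\alpha(z)=\Big(\frac{\lambda}{\alpha}+\alpha+2\Big)z^3-\Big(\frac{\lambda}{\alpha}+2\alpha+3\Big)z^2+\alpha z+1$$ for some $\alpha\in\mathbb{C}\setminus\{0,-1\pm\sqrt{1-\lambda}\}$. In particular, $f_\alpha$ has a $2$-cycle of Siegel disks, centered at $0$ and $1$ respectively, with multiplier equal to $\lambda$.
   Context: A $2$-cycle of Siegel disks of $f$ with rotation number $\theta$ ($\theta$ irrational) is a pair of distinct Fatou components interchanged by $f$, on each of which $f^{\circ 2}$ is conformally conjugate to the rotation $\zeta\mapsto e^{2\pi i\theta}\zeta$ of the unit disk; the points corresponding to $0$ are their centers, which form a $2$-cycle of $f$ with multiplier $e^{2\pi i\theta}$. Conformally conjugate means conjugate by a Möbius transformation of the Riemann sphere. The points $-1\pm\sqrt{1-\lambda}$ are the roots of $\frac{\lambda}{\alpha}+\alpha+2=0$. *)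

theory Defs
  imports "HOL-Complex_Analysis.Complex_Analysis"
begin

section \<open>The Riemann sphere\<close>

datatype rsphere = Fin complex | Infty

text \<open>Inverse stereographic projection onto the unit sphere of \<open>\<complex> \<times> \<real>\<close>; the induced distance
  is the chordal metric.\<close>

fun stereo :: "rsphere \<Rightarrow> complex \<times> real" where
  "stereo (Fin z) = ((2 / ((cmod z)\<^sup>2 + 1)) *\<^sub>R z, ((cmod z)\<^sup>2 - 1) / ((cmod z)\<^sup>2 + 1))"
| "stereo Infty = (0, 1)"

lemma inj_stereo: "inj stereo"
proof (rule injI)
  have pos: "(cmod z)\<^sup>2 + 1 > 0" for z
    by (simp add: add_nonneg_pos)
  have ne: "((cmod z)\<^sup>2 - 1) / ((cmod z)\<^sup>2 + 1) \<noteq> 1" for z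
    using pos[of z] by (simp add: divide_simps)
  have eq: "z = w" if "stereo (Fin z) = stereo (Fin w)" for z w
  proof -
    have "((cmod z)\<^sup>2 - 1) * ((cmod w)\<^sup>2 + 1) = ((cmod w)\<^sup>2 - 1) * ((cmod z)\<^sup>2 + 1)"
      using that pos[of z] pos[of w] by (simp add: frac_eq_eq)
    hence n: "(cmod z)\<^sup>2 = (cmod w)\<^sup>2"
      by (simp add: algebra_simps)
    have "(2 / ((cmod z)\<^sup>2 + 1)) *\<^sub>R z = (2 / ((cmod z)\<^sup>2 + 1)) *\<^sub>R w"
      using that n by simp
    thus ?thesis
      using pos[of z] by (simp only: scaleR_cancel_left) auto
  qed
  show "x = y" if "stereo x = stereo y" for x y
  proof (cases x)
    case (Fin z)
    note x = this
    show ?thesis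
    proof (cases y)
      case (Fin w)
      with x that eq[of z w] show ?thesis by metis
    next
      case Infty
      with x that ne[of z] show ?thesis by simp
    qed
  next
    case Infty
    with that show ?thesis
      by (cases y) (use ne in \<open>auto simp: eq_commute[of "1::real"]\<close>)
  qed
qed

instantiation rsphere :: metric_space
begin

definition dist_rsphere :: "rsphere \<Rightarrow> rsphere \<Rightarrow> real" where
  "dist_rsphere x y = dist (stereo x) (stereo y)"

definition uniformity_rsphere :: "(rsphere \<times> rsphere) filter" where
  "uniformity_rsphere = (INF e\<in>{0<..}. principal {(x, y). dist x y < e})"

definition open_rsphere :: "rsphere set \<Rightarrow> bool" where
  "open_rsphere U \<longleftrightarrow> (\<forall>x\<in>U. \<forall>\<^sub>F (x', y) in uniformity. x' = x \<longrightarrow> y \<in> U)"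

instance
proof
  show "dist x y = 0 \<longleftrightarrow> x = y" for x y :: rsphere
    using inj_stereo by (auto simp: dist_rsphere_def dest: injD)
  show "dist x y \<le> dist x z + dist y z" for x y z :: rsphere
    unfolding dist_rsphere_def by (rule dist_triangle2)
qed (simp_all add: uniformity_rsphere_def open_rsphere_def)

end

fun sphere_inverse :: "rsphere \<Rightarrow> rsphere" where
  "sphere_inverse (Fin z) = (if z = 0 then Infty else Fin (1 / z))"
| "sphere_inverse Infty = Fin 0"

text \<open>Holomorphy of a sphere-valued map on an open subset of the plane, in the two standard
  charts \<open>w\<close> and \<open>1/w\<close> of the target.\<close>

definition sphere_holomorphic_on :: "(complex \<Rightarrow> rsphere) \<Rightarrow> complex set \<Rightarrow> bool" where
  "sphere_holomorphic_on \<phi> S \<longleftrightarrow>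
     (\<forall>z\<in>S. \<exists>r>0. \<exists>h. ball z r \<subseteq> S \<and> h holomorphic_on ball z r \<and>
        ((\<forall>w\<in>ball z r. \<phi> w = Fin (h w)) \<or>
         (\<forall>w\<in>ball z r. sphere_inverse (\<phi> w) = Fin (h w))))"

fun mobius :: "complex \<Rightarrow> complex \<Rightarrow> complex \<Rightarrow> complex \<Rightarrow> rsphere \<Rightarrow> rsphere" where
  "mobius a b c d (Fin z) = (if c * z + d = 0 then Infty else Fin ((a * z + b) / (c * z + d)))"
| "mobius a b c d Infty = (if c = 0 then Infty else Fin (a / c))"

definition conformally_conjugate :: "(rsphere \<Rightarrow> rsphere) \<Rightarrow> (rsphere \<Rightarrow> rsphere) \<Rightarrow> bool" where
  "conformally_conjugate F G \<longleftrightarrow>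
     (\<exists>a b c d. a * d - b * c \<noteq> 0 \<and> mobius a b c d \<circ> F = G \<circ> mobius a b c d)"

fun sphere_poly :: "complex poly \<Rightarrow> rsphere \<Rightarrow> rsphere" where
  "sphere_poly p (Fin z) = Fin (poly p z)"
| "sphere_poly p Infty = (if degree p = 0 then Fin (coeff p 0) else Infty)"


section \<open>Fatou components and Siegel disks\<close>

definition normal_family_on :: "rsphere set \<Rightarrow> (rsphere \<Rightarrow> rsphere) set \<Rightarrow> bool" where
  "normal_family_on U \<F> \<longleftrightarrow>
     (\<forall>g :: nat \<Rightarrow> rsphere \<Rightarrow> rsphere. range g \<subseteq> \<F> \<longrightarrow>
        (\<exists>r l. strict_mono r \<and>
           (\<forall>K. compact K \<and> K \<subseteq> U \<longrightarrow> uniform_limit K (g \<circ> r) l sequentially)))"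

definition fatou_set :: "(rsphere \<Rightarrow> rsphere) \<Rightarrow> rsphere set" where
  "fatou_set F = {x. \<exists>U. open U \<and> x \<in> U \<and> normal_family_on U (range (\<lambda>n. F ^^ n))}"

text \<open>\<open>G\<close> on \<open>U\<close> is conformally conjugate to the rotation of the unit disk by \<open>\<theta>\<close>, with \<open>0\<close>
  corresponding to \<open>c\<close>. The inverse of the holomorphic bijection \<open>\<phi>\<close> is automatically
  holomorphic.\<close>

definition rotation_domain ::
    "(rsphere \<Rightarrow> rsphere) \<Rightarrow> real \<Rightarrow> rsphere set \<Rightarrow> rsphere \<Rightarrow> bool" where
  "rotation_domain G \<theta> U c \<longleftrightarrow>
     (\<exists>\<phi>. sphere_holomorphic_on \<phi> (ball 0 1) \<and> bij_betw \<phi> (ball 0 1) U \<and> \<phi> 0 = c \<and>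
        (\<forall>\<zeta>\<in>ball 0 1. G (\<phi> \<zeta>) = \<phi> (exp (2 * of_real pi * \<i> * of_real \<theta>) * \<zeta>)))"

text \<open>The disks of the cycle are \<open>U\<close> and \<open>V\<close>, with centers \<open>a\<close> and \<open>b\<close>.\<close>

definition siegel_2cycle ::
    "(rsphere \<Rightarrow> rsphere) \<Rightarrow> real \<Rightarrow> rsphere set \<Rightarrow> rsphere \<Rightarrow> rsphere set \<Rightarrow> rsphere \<Rightarrow> bool" where
  "siegel_2cycle F \<theta> U a V b \<longleftrightarrow>
     \<theta> \<notin> \<rat> \<and> U \<in> components (fatou_set F) \<and> V \<in> components (fatou_set F) \<and> U \<noteq> V \<and>
     F ` U = V \<and> F ` V = U \<and>
     rotation_domain (F ^^ 2) \<theta> U a \<and> rotation_domain (F ^^ 2) \<theta> V b"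

definition has_2cycle_with_multiplier ::
    "complex poly \<Rightarrow> complex \<Rightarrow> complex \<Rightarrow> complex \<Rightarrow> bool" where
  "has_2cycle_with_multiplier p a b \<mu> \<longleftrightarrow>
     a \<noteq> b \<and> poly p a = b \<and> poly p b = a \<and> deriv (poly p ^^ 2) a = \<mu>"

definition f_family :: "complex \<Rightarrow> complex \<Rightarrow> complex poly" where
  "f_family lam \<alpha> = [:1, \<alpha>, - (lam / \<alpha> + 2 * \<alpha> + 3), lam / \<alpha> + \<alpha> + 2:]"

end

theory Submission imports Defs begin

text \<open>
  A polynomial of positive degree fixes \<open>\<infinity>\<close> and interchanges the two disjoint disks, so neither
  disk contains \<open>\<infinity>\<close> and both centers are points of the plane. Each center is a fixed point of the
  second iterate, and an irrational rotation has no fixed point but \<open>0\<close>; since the polynomial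
  commutes with its second iterate, it interchanges the centers. Linearizing the second
  iterate by an injective, hence locally univalent, holomorphic map shows that the multiplier of
  this \<open>2\<close>-cycle is \<open>lam\<close> (\<open>siegel_2cycle_multiplier\<close>).

  The affine map that carries the centers to \<open>0\<close> and \<open>1\<close> conjugates \<open>f\<close> to a cubic \<open>g\<close>. Affine
  maps are Lipschitz for the chordal metric, as are their inverses, so they preserve normality
  and carry Fatou components to Fatou components and Siegel disks to Siegel disks
  (\<open>siegel_2cycle_affine_conjugate\<close>). Thus \<open>g\<close> has a \<open>2\<close>-cycle of Siegel disks centered at \<open>0\<close> and
  \<open>1\<close>. With \<open>\<alpha> = g'(0)\<close>, the three conditions \<open>g(0) = 1\<close>, \<open>g(1) = 0\<close> and \<open>g'(0) g'(1) = lam\<close> are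
  linear in the two remaining coefficients and determine \<open>g = f_family lam \<alpha>\<close>
  (\<open>cubic_eq_f_family\<close>). Here \<open>\<alpha> \<noteq> 0\<close> because \<open>lam \<noteq> 0\<close>, and at the other two excluded values the
  leading coefficient would vanish.
\<close>

section \<open>Affine maps of the sphere\<close>

lemma dist_Fin_Fin:
  "dist (Fin z) (Fin w) = 2 * cmod (z - w) / (sqrt ((cmod z)\<^sup>2 + 1) * sqrt ((cmod w)\<^sup>2 + 1))"
proof -
  define A B where "A = (cmod z)\<^sup>2 + 1" and "B = (cmod w)\<^sup>2 + 1"
  have pos: "A > 0" "B > 0"
    by (auto simp: A_def B_def add_nonneg_pos)
  have n1: "(cmod ((2/A) *\<^sub>R z - (2/B) *\<^sub>R w))\<^sup>2
      = (2/A)\<^sup>2 * (A - 1) + (2/B)\<^sup>2 * (B - 1) - 2 * (2/A) * (2/B) * (z \<bullet> w)"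
  proof -
    have "(cmod (p *\<^sub>R z - q *\<^sub>R w))\<^sup>2 = p\<^sup>2 * (cmod z)\<^sup>2 + q\<^sup>2 * (cmod w)\<^sup>2 - 2 * p * q * (z \<bullet> w)"
      for p q :: real
      unfolding power2_norm_eq_inner
      by (simp add: inner_diff inner_commute power2_eq_square algebra_simps)
    thus ?thesis
      by (simp add: A_def B_def)
  qed
  have zw: "z \<bullet> w = (A + B - 2 - (cmod (z - w))\<^sup>2) / 2"
    by (simp add: dot_norm_neg A_def B_def)
  have "(dist (Fin z) (Fin w))\<^sup>2
      = (cmod ((2/A) *\<^sub>R z - (2/B) *\<^sub>R w))\<^sup>2 + ((A - 2) / A - (B - 2) / B)\<^sup>2"
    unfolding dist_rsphere_def stereo.simps dist_Pair_Pair
    by (simp add: dist_norm A_def B_def)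
  also have "\<dots> = 4 * (cmod (z - w))\<^sup>2 / (A * B)"
  proof -
    define a b where "a = 1 / A" and "b = 1 / B"
    have ab: "A * a = 1" "B * b = 1"
      using pos by (simp_all add: a_def b_def)
    have "(2 * a)\<^sup>2 * (A - 1) + (2 * b)\<^sup>2 * (B - 1) - 2 * (2 * a) * (2 * b) * ((A + B - 2 - d) / 2)
        + ((1 - 2 * a) - (1 - 2 * b))\<^sup>2 = 4 * d * (a * b)" for d
      using ab by algebra
    moreover have "2 / A = 2 * a" "2 / B = 2 * b" "(A - 2) / A = 1 - 2 * a" "(B - 2) / B = 1 - 2 * b"
      "4 * d / (A * B) = 4 * d * (a * b)" for d
      using pos by (simp_all add: a_def b_def diff_divide_distrib)
    ultimately show ?thesis
      unfolding n1 zw by simp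
  qed
  also have "\<dots> = (2 * cmod (z - w) / (sqrt A * sqrt B))\<^sup>2"
    using pos by (simp add: power_divide power_mult_distrib)
  finally show ?thesis
    using pos unfolding A_def B_def
    by (subst (asm) power2_eq_iff_nonneg) auto
qed

lemma dist_Fin_Infty: "dist (Fin z) Infty = 2 / sqrt ((cmod z)\<^sup>2 + 1)"
proof -
  define A where "A = (cmod z)\<^sup>2 + 1"
  have pos: "A > 0"
    by (auto simp: A_def add_nonneg_pos)
  have "(dist (Fin z) Infty)\<^sup>2 = (2/A)\<^sup>2 * (cmod z)\<^sup>2 + ((A - 2) / A - 1)\<^sup>2"
    unfolding dist_rsphere_def stereo.simps dist_Pair_Pair
    by (simp add: dist_norm A_def power_mult_distrib power_divide)
  also have "\<dots> = (2/A)\<^sup>2 * (A - 1) + ((A - 2) / A - 1)\<^sup>2"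
    by (simp add: A_def)
  also have "\<dots> = 4 / A"
    using pos by (simp add: field_simps power2_eq_square)
  also have "\<dots> = (2 / sqrt A)\<^sup>2"
    using pos by (simp add: power_divide)
  finally show ?thesis
    using pos unfolding A_def by (subst (asm) power2_eq_iff_nonneg) auto
qed

text \<open>
  With \<open>s(z) = sqrt (|z|\<^sup>2 + 1)\<close> the chordal distance is \<open>2 |z - w| / (s(z) s(w))\<close> between points
  of the plane and \<open>2 / s(z)\<close> between \<open>z\<close> and \<open>\<infinity>\<close>. An affine map \<open>M\<close> scales the numerator by the
  constant \<open>|m|\<close>, and \<open>s(z) \<le> C s(M z)\<close> because \<open>z\<close> is again an affine function of \<open>M z\<close>; so \<open>M\<close>
  is Lipschitz.
\<close>

lemma uniformly_continuous_affine:
  assumes m: "m \<noteq> 0"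
  shows "uniformly_continuous_on UNIV (sphere_poly [:c, m:])"
proof -
  define s where "s z = sqrt ((cmod z)\<^sup>2 + 1)" for z
  have s: "s z > 0" for z
    by (simp add: s_def add_nonneg_pos)
  define C where "C = sqrt (1 + 2 * (1 + (cmod c)\<^sup>2) / (cmod m)\<^sup>2)"
  have C: "C \<ge> 0"
    by (simp add: C_def)
  have le: "s z \<le> C * s (c + z * m)" for z
  proof -
    define w where "w = c + z * m"
    have z: "z = (w - c) / m"
      using m by (simp add: w_def)
    have "(cmod (w - c))\<^sup>2 \<le> (cmod w + cmod c)\<^sup>2"
      by (intro power_mono norm_triangle_ineq4) auto
    also have "\<dots> \<le> 2 * ((cmod w)\<^sup>2 + (cmod c)\<^sup>2)"
      using sum_squares_bound[of "cmod w" "cmod c"] by (simp add: power2_sum)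
    also have "\<dots> \<le> 2 * ((1 + (cmod c)\<^sup>2) * ((cmod w)\<^sup>2 + 1))"
      by (simp add: algebra_simps)
    finally have "(cmod z)\<^sup>2 \<le> 2 * ((1 + (cmod c)\<^sup>2) * ((cmod w)\<^sup>2 + 1)) / (cmod m)\<^sup>2"
      using m by (simp add: z norm_divide power_divide divide_right_mono)
    hence "(cmod z)\<^sup>2 + 1 \<le> (1 + 2 * (1 + (cmod c)\<^sup>2) / (cmod m)\<^sup>2) * ((cmod w)\<^sup>2 + 1)"
      by (simp add: algebra_simps add_increasing)
    thus ?thesis
      unfolding s_def C_def w_def real_sqrt_mult[symmetric] by (rule real_sqrt_le_mono)
  qed
  have FF: "dist (Fin (c + z * m)) (Fin (c + w * m)) \<le> cmod m * C\<^sup>2 * dist (Fin z) (Fin w)"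
    for z w
  proof -
    have "s z * s w \<le> (C * s (c + z * m)) * (C * s (c + w * m))"
      using le s C by (intro mult_mono) (auto intro: less_imp_le mult_nonneg_nonneg)
    hence "1 / (s (c + z * m) * s (c + w * m)) \<le> C\<^sup>2 / (s z * s w)"
      using s by (simp add: field_simps power2_eq_square)
    hence "2 * cmod m * cmod (z - w) * (1 / (s (c + z * m) * s (c + w * m)))
        \<le> 2 * cmod m * cmod (z - w) * (C\<^sup>2 / (s z * s w))"
      by (intro mult_left_mono) auto
    moreover have "cmod (c + z * m - (c + w * m)) = cmod m * cmod (z - w)"
      by (simp add: norm_mult[symmetric] algebra_simps)
    ultimately show ?thesis
      by (simp add: dist_Fin_Fin s_def mult_ac)
  qed
  have FI: "dist (Fin (c + z * m)) Infty \<le> C * dist (Fin z) Infty" for z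
    using le[of z] s[of z] s[of "c + z * m"] by (simp add: dist_Fin_Infty flip: s_def)
      (simp add: field_simps)
  have "dist (sphere_poly [:c, m:] x) (sphere_poly [:c, m:] y) \<le> (cmod m * C\<^sup>2 + C) * dist x y" for x y
  proof (cases x; cases y)
    fix z w assume "x = Fin z" "y = Fin w"
    with FF[of z w] C show ?thesis
      by (simp add: distrib_right add_increasing2)
  next
    fix z assume "x = Fin z" "y = Infty"
    with FI[of z] C m show ?thesis
      by (simp add: distrib_right add_increasing)
  next
    fix w assume "x = Infty" "y = Fin w"
    with FI[of w] C m show ?thesis
      by (simp add: distrib_right add_increasing dist_commute)
  qed auto
  hence "(cmod m * C\<^sup>2 + C)-lipschitz_on UNIV (sphere_poly [:c, m:])"
    using C by (intro lipschitz_onI) auto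
  thus ?thesis
    by (rule lipschitz_on_uniformly_continuous)
qed

lemma sphere_poly_pcompose:
  assumes "degree p \<noteq> 0" "degree q \<noteq> 0"
  shows "sphere_poly (p \<circ>\<^sub>p q) = sphere_poly p \<circ> sphere_poly q"
proof
  fix x
  show "sphere_poly (p \<circ>\<^sub>p q) x = (sphere_poly p \<circ> sphere_poly q) x"
    using assms by (cases x) (auto simp: poly_pcompose degree_pcompose)
qed

lemma sphere_affine_inverse:
  assumes "m \<noteq> 0"
  shows "sphere_poly [:- c / m, 1 / m:] \<circ> sphere_poly [:c, m:] = id"
    and "sphere_poly [:c, m:] \<circ> sphere_poly [:- c / m, 1 / m:] = id"
proof -
  show "sphere_poly [:- c / m, 1 / m:] \<circ> sphere_poly [:c, m:] = id"
  proof
    show "(sphere_poly [:- c / m, 1 / m:] \<circ> sphere_poly [:c, m:]) x = id x" for x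
      using assms by (cases x) (auto simp: field_simps)
  qed
  show "sphere_poly [:c, m:] \<circ> sphere_poly [:- c / m, 1 / m:] = id"
  proof
    show "(sphere_poly [:c, m:] \<circ> sphere_poly [:- c / m, 1 / m:]) x = id x" for x
      using assms by (cases x) (auto simp: field_simps)
  qed
qed

lemma sphere_affine_eq_mobius:
  assumes "m \<noteq> 0"
  shows "sphere_poly [:c, m:] = mobius m c 0 1"
proof
  show "sphere_poly [:c, m:] x = mobius m c 0 1 x" for x
    using assms by (cases x) (auto simp: algebra_simps)
qed


section \<open>Conjugacy and Fatou components\<close>

lemma funpow_semiconj:
  assumes "M \<circ> F = G \<circ> M"
  shows "M ((F ^^ n) x) = (G ^^ n) (M x)"
proof (induction n)
  case (Suc n)
  have "M (F y) = G (M y)" for y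
    using assms by (metis comp_apply)
  with Suc show ?case
    by simp
qed simp

text \<open>
  The iterates of \<open>G\<close> are \<open>M \<circ> F ^^ n \<circ> N\<close>. Precomposition with \<open>N\<close> keeps locally uniform
  convergence since \<open>N\<close> maps compact sets to compact sets; postcomposition with \<open>M\<close> keeps it
  since \<open>M\<close> is uniformly continuous.
\<close>

lemma normal_family_on_conjugate:
  fixes F G M N :: "rsphere \<Rightarrow> rsphere"
  assumes inv: "N \<circ> M = id" "M \<circ> N = id"
    and cont: "uniformly_continuous_on UNIV M" "uniformly_continuous_on UNIV N"
    and conj: "M \<circ> F = G \<circ> M"
    and normal: "normal_family_on U (range (\<lambda>n. F ^^ n))"
  shows "normal_family_on (M ` U) (range (\<lambda>n. G ^^ n))"
  unfolding normal_family_on_def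
proof (intro allI impI)
  fix g :: "nat \<Rightarrow> rsphere \<Rightarrow> rsphere"
  assume g: "range g \<subseteq> range (\<lambda>n. G ^^ n)"
  have NM: "N (M x) = x" and MN: "M (N x) = x" for x
    using inv by (auto simp: fun_eq_iff)
  have "N \<circ> g k \<circ> M \<in> range (\<lambda>n. F ^^ n)" for k
  proof -
    obtain n where "g k = G ^^ n"
      using g by auto
    hence "N \<circ> g k \<circ> M = F ^^ n"
      by (auto simp: fun_eq_iff NM simp flip: funpow_semiconj[OF conj])
    thus ?thesis
      by auto
  qed
  hence "range (\<lambda>k. N \<circ> g k \<circ> M) \<subseteq> range (\<lambda>n. F ^^ n)"
    by auto
  with normal have "\<exists>r l. strict_mono r \<and> (\<forall>K. compact K \<and> K \<subseteq> U \<longrightarrow>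
      uniform_limit K ((\<lambda>k. N \<circ> g k \<circ> M) \<circ> r) l sequentially)"
    unfolding normal_family_on_def by (elim allE[of _ "\<lambda>k. N \<circ> g k \<circ> M"] impE)
  then obtain r l where r: "strict_mono r" and lim: "\<forall>K. compact K \<and> K \<subseteq> U \<longrightarrow>
      uniform_limit K ((\<lambda>k. N \<circ> g k \<circ> M) \<circ> r) l sequentially"
    by (elim exE conjE)
  have "uniform_limit K (g \<circ> r) (\<lambda>x. M (l (N x))) sequentially"
    if K: "compact K" "K \<subseteq> M ` U" for K
  proof -
    have "compact (N ` K)"
      using K cont(2)
      by (intro compact_continuous_image)
         (auto intro: continuous_on_subset uniformly_continuous_imp_continuous)
    moreover have "N ` K \<subseteq> U"
      using K NM by auto
    ultimately have "uniform_limit (N ` K) ((\<lambda>k. N \<circ> g k \<circ> M) \<circ> r) l sequentially"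
      using lim by simp
    hence "uniform_limit K (\<lambda>k x. ((\<lambda>k. N \<circ> g k \<circ> M) \<circ> r) k (N x)) (\<lambda>x. l (N x)) sequentially"
      by (rule uniform_limit_compose') auto
    hence "uniform_limit K (\<lambda>k x. M (((\<lambda>k. N \<circ> g k \<circ> M) \<circ> r) k (N x)))
        (M \<circ> (\<lambda>x. l (N x))) sequentially"
      by (rule uniform_limit_compose[OF _ cont(1)]) auto
    thus ?thesis
      by (simp add: MN comp_def)
  qed
  with r show "\<exists>r l. strict_mono r \<and>
      (\<forall>K. compact K \<and> K \<subseteq> M ` U \<longrightarrow> uniform_limit K (g \<circ> r) l sequentially)"
    by (intro exI[of _ r] exI[of _ "\<lambda>x. M (l (N x))"]) simp
qed

lemma fatou_set_conjugate_subset: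
  assumes inv: "N \<circ> M = id" "M \<circ> N = id"
    and cont: "uniformly_continuous_on UNIV M" "uniformly_continuous_on UNIV N"
    and conj: "M \<circ> F = G \<circ> M"
  shows "M ` fatou_set F \<subseteq> fatou_set G"
proof
  fix y assume "y \<in> M ` fatou_set F"
  then obtain x U where y: "y = M x" and U: "open U" "x \<in> U"
    and normal: "normal_family_on U (range (\<lambda>n. F ^^ n))"
    by (auto simp: fatou_set_def)
  have "M ` U = N -` U"
    using inv by (auto simp: fun_eq_iff image_iff intro: bexI[of _ "N x" for x] sym)
  hence "open (M ` U)"
    using U cont(2) by (auto intro: open_vimage uniformly_continuous_imp_continuous)
  moreover have "y \<in> M ` U"
    using U y by auto
  ultimately show "y \<in> fatou_set G"
    using normal_family_on_conjugate[OF assms normal] by (auto simp: fatou_set_def)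
qed

lemma fatou_set_conjugate:
  assumes inv: "N \<circ> M = id" "M \<circ> N = id"
    and cont: "uniformly_continuous_on UNIV M" "uniformly_continuous_on UNIV N"
    and conj: "M \<circ> F = G \<circ> M"
  shows "fatou_set G = M ` fatou_set F"
proof
  have "N \<circ> G = N \<circ> (G \<circ> M) \<circ> N"
    using inv by (simp add: comp_assoc)
  also have "\<dots> = F \<circ> N"
    using inv by (simp add: conj[symmetric] flip: comp_assoc)
  finally have "N ` fatou_set G \<subseteq> fatou_set F"
    using fatou_set_conjugate_subset[of M N] assms by blast
  hence "M ` N ` fatou_set G \<subseteq> M ` fatou_set F"
    by blast
  thus "fatou_set G \<subseteq> M ` fatou_set F"
    by (simp add: image_comp inv)
  show "M ` fatou_set F \<subseteq> fatou_set G"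
    by (rule fatou_set_conjugate_subset[OF assms])
qed

lemma components_homeomorphic_image:
  assumes inv: "N \<circ> M = id" "M \<circ> N = id"
    and cont: "continuous_on UNIV M" "continuous_on UNIV N"
    and U: "U \<in> components S"
  shows "M ` U \<in> components (M ` S)"
  unfolding in_components_maximal
proof (intro conjI allI impI)
  show "M ` U \<noteq> {}" "M ` U \<subseteq> M ` S"
    using U by (auto dest: in_components_nonempty in_components_subset)
  show "connected (M ` U)"
    using U cont by (meson connected_continuous_image continuous_on_subset in_components_connected top_greatest)
  fix D assume D: "D \<noteq> {} \<and> M ` U \<subseteq> D \<and> D \<subseteq> M ` S \<and> connected D"
  have MN: "M ` N ` A = A" and NM: "N ` M ` B = B" for A B
    using inv by (simp_all add: image_comp)
  have "connected (N ` D)"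
    using D cont by (meson connected_continuous_image continuous_on_subset top_greatest)
  moreover have "U \<subseteq> N ` D" "N ` D \<subseteq> S"
    using image_mono[of "M ` U" D N] image_mono[of D "M ` S" N] D by (auto simp: NM)
  moreover have "N ` D \<noteq> {}"
    using D by simp
  ultimately have "N ` D = U"
    using U by (simp add: in_components_maximal)
  thus "D = M ` U"
    using MN[of D] by simp
qed


section \<open>Siegel disks in the plane\<close>

lemma sphere_holomorphic_on_Fin_iff:
  assumes "open S"
  shows "sphere_holomorphic_on (\<lambda>z. Fin (h z)) S \<longleftrightarrow> h holomorphic_on S"
proof
  assume hol: "h holomorphic_on S"
  show "sphere_holomorphic_on (\<lambda>z. Fin (h z)) S"
    unfolding sphere_holomorphic_on_def
  proof
    fix z assume "z \<in> S"
    then obtain r where "r > 0" "ball z r \<subseteq> S"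
      using assms openE by blast
    with hol show "\<exists>r>0. \<exists>k. ball z r \<subseteq> S \<and> k holomorphic_on ball z r \<and>
        ((\<forall>w\<in>ball z r. Fin (h w) = Fin (k w)) \<or>
         (\<forall>w\<in>ball z r. sphere_inverse (Fin (h w)) = Fin (k w)))"
      by (intro exI[of _ r] exI[of _ h]) (auto intro: holomorphic_on_subset)
  qed
next
  assume sph: "sphere_holomorphic_on (\<lambda>z. Fin (h z)) S"
  have "h analytic_on S"
    unfolding analytic_on_def
  proof
    fix z assume "z \<in> S"
    then obtain r k where r: "r > 0" and k: "k holomorphic_on ball z r"
      and chart: "(\<forall>w\<in>ball z r. Fin (h w) = Fin (k w)) \<or>
        (\<forall>w\<in>ball z r. sphere_inverse (Fin (h w)) = Fin (k w))"
      using sph unfolding sphere_holomorphic_on_def by blast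
    from chart have "h holomorphic_on ball z r"
    proof
      assume "\<forall>w\<in>ball z r. Fin (h w) = Fin (k w)"
      hence "k w = h w" if "w \<in> ball z r" for w
        using that by simp
      with k show ?thesis
        by (rule holomorphic_transform)
    next
      assume *: "\<forall>w\<in>ball z r. sphere_inverse (Fin (h w)) = Fin (k w)"
      have eq: "k w \<noteq> 0" "h w = 1 / k w" if "w \<in> ball z r" for w
      proof -
        have "h w \<noteq> 0" "k w = 1 / h w"
          using *[rule_format, OF that] by (auto split: if_splits)
        thus "k w \<noteq> 0" "h w = 1 / k w"
          by simp_all
      qed
      have "(\<lambda>w. 1 / k w) holomorphic_on ball z r"
        using k eq by (intro holomorphic_intros) auto
      thus ?thesis
        by (rule holomorphic_transform) (rule eq(2)[symmetric])
    qed
    with r show "\<exists>e>0. h holomorphic_on ball z e"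
      by blast
  qed
  thus "h holomorphic_on S"
    by (rule analytic_imp_holomorphic)
qed

text \<open>
  A rotation domain in the plane has an ordinary holomorphic uniformization, which makes
  derivatives and composition with polynomials available.
\<close>

lemma rotation_domain_plane_iff:
  assumes "Infty \<notin> U"
  shows "rotation_domain G \<theta> U c \<longleftrightarrow>
    (\<exists>h. h holomorphic_on ball 0 1 \<and> inj_on h (ball 0 1) \<and> U = Fin ` h ` ball 0 1 \<and> c = Fin (h 0) \<and>
       (\<forall>\<zeta>\<in>ball 0 1. G (Fin (h \<zeta>)) = Fin (h (exp (2 * of_real pi * \<i> * of_real \<theta>) * \<zeta>))))"
    (is "_ \<longleftrightarrow> (\<exists>h. ?P h)")
proof
  assume "rotation_domain G \<theta> U c"
  then obtain \<phi> where sph: "sphere_holomorphic_on \<phi> (ball 0 1)" and bij: "bij_betw \<phi> (ball 0 1) U"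
    and "\<phi> 0 = c"
    and rot: "\<And>\<zeta>. \<zeta> \<in> ball 0 1 \<Longrightarrow> G (\<phi> \<zeta>) = \<phi> (exp (2 * of_real pi * \<i> * of_real \<theta>) * \<zeta>)"
    unfolding rotation_domain_def by blast
  define h where "h z = (case \<phi> z of Fin w \<Rightarrow> w | Infty \<Rightarrow> 0)" for z
  have \<phi>: "\<phi> z = Fin (h z)" if "z \<in> ball 0 1" for z
    using bij_betwE[OF bij, rule_format, OF that] assms by (auto simp: h_def split: rsphere.split)
  have "sphere_holomorphic_on (\<lambda>z. Fin (h z)) (ball 0 1)"
    using sph \<phi> unfolding sphere_holomorphic_on_def by (metis subset_iff)
  hence "h holomorphic_on ball 0 1"
    by (simp add: sphere_holomorphic_on_Fin_iff)
  moreover have "inj_on h (ball 0 1)"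
    using bij \<phi> by (simp add: bij_betw_def inj_on_def)
  moreover have "U = Fin ` h ` ball 0 1"
    using bij \<phi> by (simp add: bij_betw_def image_image)
  moreover have "c = Fin (h 0)"
    using \<open>\<phi> 0 = c\<close> \<phi>[of 0] by simp
  moreover have "G (Fin (h \<zeta>)) = Fin (h (exp (2 * of_real pi * \<i> * of_real \<theta>) * \<zeta>))"
    if "\<zeta> \<in> ball 0 1" for \<zeta>
    using rot[OF that] that by (simp add: norm_mult flip: \<phi>)
  ultimately show "\<exists>h. ?P h"
    by blast
next
  assume "\<exists>h. ?P h"
  then obtain h where h: "?P h"
    by blast
  hence "bij_betw (\<lambda>z. Fin (h z)) (ball 0 1) U"
    by (auto simp: bij_betw_def inj_on_def image_image)
  with h show "rotation_domain G \<theta> U c"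
    unfolding rotation_domain_def
    by (intro exI[of _ "\<lambda>z. Fin (h z)"]) (auto simp: sphere_holomorphic_on_Fin_iff)
qed

lemma rotation_domain_affine_conjugate:
  assumes m: "m \<noteq> 0" and U: "Infty \<notin> U"
    and conj: "sphere_poly [:c, m:] \<circ> F = G \<circ> sphere_poly [:c, m:]"
    and rot: "rotation_domain F \<theta> U a"
  shows "rotation_domain G \<theta> (sphere_poly [:c, m:] ` U) (sphere_poly [:c, m:] a)"
proof -
  from rot U obtain h where h: "h holomorphic_on ball 0 1" "inj_on h (ball 0 1)"
    "U = Fin ` h ` ball 0 1" "a = Fin (h 0)"
    and F: "\<And>\<zeta>. \<zeta> \<in> ball 0 1 \<Longrightarrow>
      F (Fin (h \<zeta>)) = Fin (h (exp (2 * of_real pi * \<i> * of_real \<theta>) * \<zeta>))"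
    by (auto simp: rotation_domain_plane_iff)
  let ?k = "\<lambda>z. c + h z * m"
  have "?k holomorphic_on ball 0 1"
    using h by (intro holomorphic_intros)
  moreover have "inj_on ?k (ball 0 1)"
    using h m by (auto simp: inj_on_def)
  moreover have "sphere_poly [:c, m:] ` U = Fin ` ?k ` ball 0 1"
    by (auto simp: h image_image)
  moreover have "G (Fin (?k \<zeta>)) = Fin (?k (exp (2 * of_real pi * \<i> * of_real \<theta>) * \<zeta>))"
    if "\<zeta> \<in> ball 0 1" for \<zeta>
    using F[OF that] conj[THEN fun_cong, of "Fin (h \<zeta>)"] by simp
  moreover have "Infty \<notin> sphere_poly [:c, m:] ` U"
    by (auto simp: h)
  ultimately show ?thesis
    by (subst rotation_domain_plane_iff) (auto simp: h intro!: exI[of _ ?k])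
qed

lemma rotation_domain_center_fixed:
  assumes "rotation_domain G \<theta> U c"
  shows "c \<in> U" "G c = c"
proof -
  obtain \<phi> where \<phi>: "bij_betw \<phi> (ball 0 1) U" "\<phi> 0 = c"
    and rot: "\<And>\<zeta>. \<zeta> \<in> ball 0 1 \<Longrightarrow> G (\<phi> \<zeta>) = \<phi> (exp (2 * of_real pi * \<i> * of_real \<theta>) * \<zeta>)"
    using assms unfolding rotation_domain_def by blast
  show "c \<in> U"
    using bij_betw_apply[OF \<phi>(1), of 0] \<phi>(2) by simp
  show "G c = c"
    using rot[of 0] \<phi>(2) by simp
qed

lemma rotation_factor_neq_1:
  assumes "\<theta> \<notin> \<rat>"
  shows "exp (2 * of_real pi * \<i> * of_real \<theta>) \<noteq> 1"
proof
  assume "exp (2 * of_real pi * \<i> * of_real \<theta>) = 1"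
  then obtain n :: int where "2 * pi * \<theta> = of_int (2 * n) * pi"
    by (auto simp: exp_eq_1)
  hence "\<theta> = of_int n"
    by simp
  with assms show False
    by simp
qed

lemma rotation_domain_fixed_point_unique:
  assumes "\<theta> \<notin> \<rat>" and "rotation_domain G \<theta> U c" and "x \<in> U" and "G x = x"
  shows "x = c"
proof -
  define \<mu> where "\<mu> = exp (2 * of_real pi * \<i> * of_real \<theta> :: complex)"
  obtain \<phi> where bij: "bij_betw \<phi> (ball 0 1) U" and c: "\<phi> 0 = c"
    and rot: "\<And>\<zeta>. \<zeta> \<in> ball 0 1 \<Longrightarrow> G (\<phi> \<zeta>) = \<phi> (\<mu> * \<zeta>)"
    using assms(2) unfolding rotation_domain_def \<mu>_def by blast
  obtain \<zeta> where \<zeta>: "\<zeta> \<in> ball 0 1" "x = \<phi> \<zeta>"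
    using bij \<open>x \<in> U\<close> by (auto simp: bij_betw_def)
  have "\<mu> * \<zeta> \<in> ball 0 1"
    using \<zeta> by (simp add: \<mu>_def norm_mult)
  hence "\<mu> * \<zeta> = \<zeta>"
    using bij rot[OF \<zeta>(1)] \<zeta> \<open>G x = x\<close> by (metis bij_betw_def inj_onD)
  hence "\<zeta> = 0"
    using rotation_factor_neq_1[OF assms(1)] by (simp add: \<mu>_def)
  thus ?thesis
    using \<zeta> c by simp
qed


section \<open>The centers of a 2-cycle of Siegel disks\<close>

lemma siegel_2cycle_disjoint:
  assumes "siegel_2cycle F \<theta> U a V b"
  shows "U \<inter> V = {}"
proof -
  have "U \<in> components (fatou_set F)" "V \<in> components (fatou_set F)" "U \<noteq> V"
    using assms by (simp_all add: siegel_2cycle_def)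
  thus ?thesis
    using components_nonoverlap by metis
qed

text \<open>
  \<open>F\<close> commutes with \<open>F ^^ 2\<close>, so it maps the fixed point \<open>a\<close> of \<open>F ^^ 2\<close> in \<open>U\<close> to a fixed point
  of \<open>F ^^ 2\<close> in \<open>V\<close>, and \<open>b\<close> is the only one there.
\<close>

lemma siegel_2cycle_centers:
  assumes "siegel_2cycle F \<theta> U a V b"
  shows "F a = b" "F b = a" "a \<noteq> b"
proof -
  have sg: "\<theta> \<notin> \<rat>" "F ` U = V" "F ` V = U"
    "rotation_domain (F ^^ 2) \<theta> U a" "rotation_domain (F ^^ 2) \<theta> V b"
    using assms by (auto simp: siegel_2cycle_def)
  note a = rotation_domain_center_fixed[OF sg(4)] and b = rotation_domain_center_fixed[OF sg(5)]
  have "(F ^^ 2) (F a) = F a" "(F ^^ 2) (F b) = F b"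
    using a b by (auto simp: numeral_2_eq_2)
  thus "F a = b" "F b = a"
    using rotation_domain_fixed_point_unique[OF sg(1) sg(5), of "F a"]
      rotation_domain_fixed_point_unique[OF sg(1) sg(4), of "F b"] a b sg(2,3) by auto
  show "a \<noteq> b"
    using siegel_2cycle_disjoint[OF assms] a b by auto
qed

lemma siegel_2cycle_plane:
  assumes "siegel_2cycle F \<theta> U a V b" and "F Infty = Infty"
  shows "Infty \<notin> U" "Infty \<notin> V"
proof -
  have "F ` U = V" "F ` V = U"
    using assms(1) by (simp_all add: siegel_2cycle_def)
  hence "Infty \<in> U \<longleftrightarrow> Infty \<in> V"
    using \<open>F Infty = Infty\<close> imageI[of Infty U F] imageI[of Infty V F] by auto
  thus "Infty \<notin> U" "Infty \<notin> V"
    using siegel_2cycle_disjoint[OF assms(1)] by auto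
qed

lemma siegel_2cycle_affine_conjugate:
  assumes m: "m \<noteq> 0" and siegel: "siegel_2cycle F \<theta> U a V b" and "F Infty = Infty"
    and conj: "sphere_poly [:c, m:] \<circ> F = G \<circ> sphere_poly [:c, m:]"
  shows "siegel_2cycle G \<theta> (sphere_poly [:c, m:] ` U) (sphere_poly [:c, m:] a)
    (sphere_poly [:c, m:] ` V) (sphere_poly [:c, m:] b)"
proof -
  define M where "M = sphere_poly [:c, m:]"
  define N where "N = sphere_poly [:- c / m, 1 / m:]"
  have inv: "N \<circ> M = id" "M \<circ> N = id"
    unfolding M_def N_def by (rule sphere_affine_inverse[OF m])+
  have cont: "uniformly_continuous_on UNIV M" "uniformly_continuous_on UNIV N"
    unfolding M_def N_def using m by (auto intro!: uniformly_continuous_affine)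
  have conj': "M \<circ> F = G \<circ> M" "M \<circ> F ^^ 2 = G ^^ 2 \<circ> M"
    using conj funpow_semiconj[OF conj, of 2] by (simp_all add: M_def fun_eq_iff)
  have comp: "M ` W \<in> components (fatou_set G)" if "W \<in> components (fatou_set F)" for W
    unfolding fatou_set_conjugate[OF inv cont conj'(1)]
    using that cont
    by (intro components_homeomorphic_image[OF inv]) (auto intro: uniformly_continuous_imp_continuous)
  have "inj M"
    using inv(1) by (metis inj_on_id inj_on_imageI2)
  have img: "G ` M ` W = M ` F ` W" for W
    by (simp add: image_comp conj'(1))
  show ?thesis
    using siegel comp \<open>inj M\<close> siegel_2cycle_plane[OF siegel \<open>F Infty = Infty\<close>] conj'(2)
      rotation_domain_affine_conjugate[OF m, of _ c "F ^^ 2" "G ^^ 2"]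
    unfolding siegel_2cycle_def M_def[symmetric]
    by (auto simp: img inj_image_eq_iff)
qed

text \<open>
  Differentiating \<open>p (p (h \<zeta>)) = h (\<mu> \<zeta>)\<close> at \<open>0\<close> gives \<open>(p \<circ> p)'(a) h'(0) = \<mu> h'(0)\<close>, and
  \<open>h'(0) \<noteq> 0\<close> because \<open>h\<close> is injective.
\<close>

lemma siegel_2cycle_multiplier:
  assumes siegel: "siegel_2cycle (sphere_poly p) \<theta> U (Fin a) V (Fin b)" and p: "degree p \<noteq> 0"
  shows "has_2cycle_with_multiplier p a b (exp (2 * of_real pi * \<i> * of_real \<theta>))"
proof -
  define \<mu> where "\<mu> = exp (2 * of_real pi * \<i> * of_real \<theta> :: complex)"
  have swap: "poly p a = b" "poly p b = a" "a \<noteq> b"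
    using siegel_2cycle_centers[OF siegel] by auto
  have "Infty \<notin> U"
    using siegel_2cycle_plane[OF siegel] p by simp
  moreover have "rotation_domain (sphere_poly p ^^ 2) \<theta> U (Fin a)"
    using siegel by (simp add: siegel_2cycle_def)
  ultimately obtain h where h: "h holomorphic_on ball 0 1" "inj_on h (ball 0 1)" "h 0 = a"
    and rot: "\<And>\<zeta>. \<zeta> \<in> ball 0 1 \<Longrightarrow> (poly p ^^ 2) (h \<zeta>) = h (\<mu> * \<zeta>)"
    unfolding \<mu>_def by (auto simp: rotation_domain_plane_iff numeral_2_eq_2)
  have h': "(h has_field_derivative deriv h 0) (at 0)"
    using h by (auto intro!: holomorphic_derivI[of h "ball 0 1"])
  have "deriv h 0 \<noteq> 0"
    using h by (intro holomorphic_injective_imp_regular[of h "ball 0 1"]) auto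
  have "(poly p ^^ 2) = poly (p \<circ>\<^sub>p p)"
    by (auto simp: numeral_2_eq_2 poly_pcompose)
  hence "((poly p ^^ 2) has_field_derivative deriv (poly p ^^ 2) a) (at (h 0))"
    using h by (simp add: DERIV_deriv_iff_field_differentiable)
       (auto intro!: holomorphic_on_imp_differentiable_at[of _ UNIV] holomorphic_intros)
  from DERIV_chain2[OF this h']
  have "((\<lambda>\<zeta>. (poly p ^^ 2) (h \<zeta>)) has_field_derivative deriv (poly p ^^ 2) a * deriv h 0) (at 0)" .
  moreover have "((\<lambda>\<zeta>. (poly p ^^ 2) (h \<zeta>)) has_field_derivative deriv h 0 * \<mu>) (at 0)"
  proof (rule has_field_derivative_transform_within_open[of _ _ _ "ball 0 1"])
    have "(h has_field_derivative deriv h 0) (at (\<mu> * 0))"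
      using h' by simp
    moreover have "((\<lambda>\<zeta>. \<mu> * \<zeta>) has_field_derivative \<mu>) (at 0)"
      by (auto intro!: derivative_eq_intros)
    ultimately show "((\<lambda>\<zeta>. h (\<mu> * \<zeta>)) has_field_derivative deriv h 0 * \<mu>) (at 0)"
      by (rule DERIV_chain2)
  qed (simp_all add: rot)
  ultimately have "deriv (poly p ^^ 2) a * deriv h 0 = deriv h 0 * \<mu>"
    by (rule DERIV_unique)
  thus ?thesis
    using \<open>deriv h 0 \<noteq> 0\<close> swap unfolding has_2cycle_with_multiplier_def \<mu>_def by simp
qed


section \<open>The normal form\<close>

text \<open>
  The chain rule turns the multiplier condition into \<open>g'(1) = lam / \<alpha>\<close> with \<open>\<alpha> = g'(0)\<close>, that is
  \<open>\<alpha> + 2 B + 3 C = lam / \<alpha>\<close>; together with \<open>1 + \<alpha> + B + C = 0\<close> this is a linear system of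
  determinant \<open>1\<close> for \<open>B\<close> and \<open>C\<close>. The values \<open>-1 \<plusminus> sqrt (1 - lam)\<close> are the zeros of
  \<open>\<alpha> C = \<alpha>\<^sup>2 + 2 \<alpha> + lam\<close>, and \<open>C \<noteq> 0\<close> by the degree.
\<close>

lemma cubic_eq_f_family:
  assumes deg: "degree g = 3" and cycle: "has_2cycle_with_multiplier g 0 1 lam" and "lam \<noteq> 0"
  shows "\<exists>\<alpha>. \<alpha> \<notin> {0, -1 + csqrt (1 - lam), -1 - csqrt (1 - lam)} \<and> g = f_family lam \<alpha>"
proof -
  define \<alpha> B C where "\<alpha> = coeff g 1" and "B = coeff g 2" and "C = coeff g 3"
  have g: "g = [:coeff g 0, \<alpha>, B, C:]"
    using deg by (intro poly_eqI)
      (auto simp: \<alpha>_def B_def C_def coeff_pCons numeral_2_eq_2 numeral_3_eq_3 coeff_eq_0 split: nat.split)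
  have "coeff g 0 = 1"
    using cycle by (simp add: has_2cycle_with_multiplier_def flip: poly_0_coeff_0)
  with g have g: "g = [:1, \<alpha>, B, C:]"
    by simp
  have g1: "1 + \<alpha> + B + C = 0"
    using cycle by (simp add: has_2cycle_with_multiplier_def g add_ac)
  have "C \<noteq> 0"
    using deg by (metis C_def degree_0 leading_coeff_neq_0 zero_neq_numeral)
  have "lam = deriv (poly g ^^ 2) 0"
    using cycle by (simp add: has_2cycle_with_multiplier_def)
  also have "poly g ^^ 2 = poly (g \<circ>\<^sub>p g)"
    by (auto simp: numeral_2_eq_2 poly_pcompose)
  also have "deriv (poly (g \<circ>\<^sub>p g)) 0 = poly (pderiv g) 1 * poly (pderiv g) 0"
    using cycle by (simp add: DERIV_imp_deriv[OF poly_DERIV] pderiv_pcompose poly_pcompose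
        has_2cycle_with_multiplier_def)
  finally have lam: "lam = (\<alpha> + 2 * B + 3 * C) * \<alpha>"
    by (simp add: g pderiv_pCons algebra_simps)
  have "\<alpha> \<noteq> 0"
    using lam \<open>lam \<noteq> 0\<close> by auto
  have div: "lam / \<alpha> = \<alpha> + 2 * B + 3 * C"
    using lam \<open>\<alpha> \<noteq> 0\<close> by simp
  have B: "B = - (1 + \<alpha> + C)"
    using g1 by (simp add: eq_neg_iff_add_eq_0 algebra_simps)
  have C: "C = lam / \<alpha> + \<alpha> + 2"
    unfolding div B by (simp add: algebra_simps)
  have "B = - (lam / \<alpha> + 2 * \<alpha> + 3)"
    using B by (subst (asm) C) (simp add: algebra_simps)
  with C g have "g = f_family lam \<alpha>"
    by (simp add: f_family_def)
  moreover have "\<alpha> \<notin> {-1 + csqrt (1 - lam), -1 - csqrt (1 - lam)}"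
  proof
    assume "\<alpha> \<in> {-1 + csqrt (1 - lam), -1 - csqrt (1 - lam)}"
    hence "(\<alpha> + 1)\<^sup>2 = (csqrt (1 - lam))\<^sup>2"
      by (auto simp: power2_eq_square)
    hence "(\<alpha> + 1)\<^sup>2 = 1 - lam"
      by simp
    hence "lam + \<alpha> * \<alpha> + 2 * \<alpha> = 0"
      by (simp add: power2_eq_square algebra_simps)
    moreover have "C * \<alpha> = lam + \<alpha> * \<alpha> + 2 * \<alpha>"
      unfolding C using \<open>\<alpha> \<noteq> 0\<close> by (simp add: field_simps)
    ultimately show False
      using \<open>C \<noteq> 0\<close> \<open>\<alpha> \<noteq> 0\<close> by simp
  qed
  ultimately show ?thesis
    using \<open>\<alpha> \<noteq> 0\<close> by blast
qed

theorem proposition2p1: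
  fixes f :: "complex poly" and \<theta> :: real and lam :: complex
  assumes cubic: "degree f = 3"
    and siegel: "\<exists>U a V b. siegel_2cycle (sphere_poly f) \<theta> U a V b"
    and lambda: "lam = exp (2 * of_real pi * \<i> * of_real \<theta>)"
  shows "\<exists>\<alpha>. \<alpha> \<notin> {0, -1 + csqrt (1 - lam), -1 - csqrt (1 - lam)} \<and>
           conformally_conjugate (sphere_poly f) (sphere_poly (f_family lam \<alpha>)) \<and>
           (\<exists>U V. siegel_2cycle (sphere_poly (f_family lam \<alpha>)) \<theta> U (Fin 0) V (Fin 1)) \<and>
           has_2cycle_with_multiplier (f_family lam \<alpha>) 0 1 lam"
proof -
  obtain U V a' b' where sg: "siegel_2cycle (sphere_poly f) \<theta> U a' V b'"
    using siegel by blast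
  have infty: "sphere_poly f Infty = Infty"
    using cubic by simp
  have "a' \<in> U" "b' \<in> V"
    using sg by (auto simp: siegel_2cycle_def intro: rotation_domain_center_fixed)
  then obtain a b where ab: "a' = Fin a" "b' = Fin b"
    using siegel_2cycle_plane[OF sg infty] by (metis rsphere.exhaust)
  have "a \<noteq> b"
    using siegel_2cycle_centers[OF sg] ab by auto
  define m c where "m = 1 / (b - a)" and "c = - a / (b - a)"
  have m: "m \<noteq> 0"
    using \<open>a \<noteq> b\<close> by (simp add: m_def)
  define g where "g = [:c, m:] \<circ>\<^sub>p f \<circ>\<^sub>p [:- c / m, 1 / m:]"
  have deg: "degree g = 3"
    using m cubic by (simp add: g_def degree_pcompose)
  have "sphere_poly g = sphere_poly [:c, m:] \<circ> sphere_poly f \<circ> sphere_poly [:- c / m, 1 / m:]"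
    using m cubic by (simp add: g_def sphere_poly_pcompose degree_pcompose)
  hence conj: "sphere_poly [:c, m:] \<circ> sphere_poly f = sphere_poly g \<circ> sphere_poly [:c, m:]"
    by (simp only: comp_assoc sphere_affine_inverse[OF m] comp_id)
  have "sphere_poly [:c, m:] a' = Fin 0" "sphere_poly [:c, m:] b' = Fin 1"
    using \<open>a \<noteq> b\<close> by (auto simp: ab m_def c_def simp flip: diff_divide_distrib)
  with siegel_2cycle_affine_conjugate[OF m sg infty conj]
  have sg': "siegel_2cycle (sphere_poly g) \<theta> (sphere_poly [:c, m:] ` U) (Fin 0)
      (sphere_poly [:c, m:] ` V) (Fin 1)"
    by simp
  have cycle: "has_2cycle_with_multiplier g 0 1 lam"
    unfolding lambda using siegel_2cycle_multiplier[OF sg'] deg by simp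
  have "conformally_conjugate (sphere_poly f) (sphere_poly g)"
    unfolding conformally_conjugate_def
    using m conj by (intro exI[of _ m] exI[of _ c] exI[of _ 0] exI[of _ 1])
      (simp flip: sphere_affine_eq_mobius)
  moreover obtain \<alpha> where "\<alpha> \<notin> {0, -1 + csqrt (1 - lam), -1 - csqrt (1 - lam)}"
    and "g = f_family lam \<alpha>"
    using cubic_eq_f_family[OF deg cycle] lambda by auto
  ultimately show ?thesis
    using sg' cycle by blast
qed

end
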